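(* Suppose $F$ is Lipschitz-continuous in both variables and bounded, i.e. there exist constants $L$ and $B$ such that $\|F(Y,s)-F(Z,t)\|\le L\|Y-Z\|+L|s-t|$ and $\|F(X,t)\|\le B$ for all matrices $X,Y,Z\in\mathbb{R}^{m_1\times m_2}$ and all times $s,t$. Let $\mathcal{X}$ denote the value at $t^{n+1}=t^n+\Delta t$ of the exact solution of $\frac{d}{dt}X(t)=F(X(t),t)$ on $[t^n,t^{n+1}]$ with initial condition $X(t^n)=\hat X^n=U^n\Sigma^n(V^n)^T$, and let $\hat X^{n+1}$ be the numerical solution obtained from the same $\hat X^n$ by one step of the cheap-prediction scheme (Steps 1-4 of the Merge-adapt method, defined in the context) with tolerances $\epsilon_1,\epsilon_2\ge0$. Then for sufficiently small $\Delta t$, $$\|\mathcal{X}-\hat X^{n+1}\|\le C\Delta t^2+2\Delta t\,\epsilon_1+\epsilon_2,$$ where $C$ is a constant that depends only on $L$ and $B$.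
   Context: Setting. Consider the matrix differential equation $\frac{d}{dt}X(t)=F(X(t),t)$, $X(t)\in\mathbb{R}^{m_1\times m_2}$, where $F(X,t)=\sum_{j=1}^{s_{\rm sep}}A_jXB_j^T+G(t)$ with $A_j\in\mathbb{R}^{m_1\times m_1}$, $B_j\in\mathbb{R}^{m_2\times m_2}$ and $G(t)\in\mathbb{R}^{m_1\times m_2}$ given. $\|\cdot\|$ is the Frobenius norm. Truncation. For a matrix $A$ of rank $r$ with reduced SVD $A=U\,\mathrm{diag}(\sigma_1,\dots,\sigma_r)V^T$, $\sigma_1\ge\dots\ge\sigma_r>0$, the truncated SVD $\mathcal{T}^{svd}_\epsilon(A)$ keeps the leading $s$ singular triplets, where $s$ is the smallest integer with $(\sum_{j=s+1}^r\sigma_j^2)^{1/2}\le\epsilon$; thus $\|A-\mathcal{T}^{svd}_\epsilon(A)\|\le\epsilon$. $\mathcal{T}^{sum}_\epsilon(\sum_j X_j)$ denotes the truncated SVD, with tolerance $\epsilon$, of a sum of low rank matrices. Cheap-prediction scheme (Steps 1-4 of the Merge-adapt method). Input: $\hat X^n=U^n\Sigma^n(V^n)^T$ in SVD form ($U^n,V^n$ with orthonormal columns). 1. Compute the truncated SVD $\mathcal{U}\mathcal{S}\mathcal{V}^T=\mathcal{T}^{sum}_{\epsilon_1}(F(\hat X^n,t^n))$. 2. Let $\tilde U\in\mathbb{R}^{m_1\times s_1}$ and $\tilde V\in\mathbb{R}^{m_2\times s_2}$ be matrices with orthonormal columns whose column spaces are those of $[U^n,\mathcal{U}]$ and $[V^n,\mathcal{V}]$,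 respectively (computed by column-pivoted QR). 3. (Galerkin evolution) Find $\tilde\Sigma\in\mathbb{R}^{s_1\times s_2}$ solving $\tilde\Sigma=\tilde U^T\big(\hat X^n+\Delta t\,F(\tilde U\tilde\Sigma\tilde V^T,t^{n+1})\big)\tilde V$. 4. (Truncation) Output $\hat X^{n+1}=\tilde U\,\mathcal{T}^{svd}_{\epsilon_2}(\tilde\Sigma)\,\tilde V^T$. *)

theory Defs
  imports Complex_Main "Jordan_Normal_Form.VS_Connect"
begin

(* Matrices have explicit dimensions (carrier_mat), not dimensions encoded in types, so that the
   constant of the estimate can be quantified before the dimensions m1, m2, and because the
   ranks s1, s2 of the Galerkin bases vary. *)

definition frob_norm :: "real mat \<Rightarrow> real" where
  "frob_norm A = sqrt (\<Sum>i<dim_row A. \<Sum>j<dim_col A. (A $$ (i, j))\<^sup>2)"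

(* The sum over j < k is written entrywise since matrices do not form a comm_monoid_add. *)
definition affine_rhs ::
  "nat \<Rightarrow> nat \<Rightarrow> nat \<Rightarrow> (nat \<Rightarrow> real mat) \<Rightarrow> (nat \<Rightarrow> real mat) \<Rightarrow> (real \<Rightarrow> real mat)
    \<Rightarrow> real mat \<Rightarrow> real \<Rightarrow> real mat" where
  "affine_rhs m1 m2 k A B G X t =
     mat m1 m2 (\<lambda>(p, q). \<Sum>j<k. (A j * X * transpose_mat (B j)) $$ (p, q)) + G t"

definition ode_solution ::
  "nat \<Rightarrow> nat \<Rightarrow> (real mat \<Rightarrow> real \<Rightarrow> real mat) \<Rightarrow> real \<Rightarrow> real \<Rightarrow> (real \<Rightarrow> real mat) \<Rightarrow> bool" where
  "ode_solution m1 m2 F a b X \<longleftrightarrow>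
     (\<forall>t\<in>{a..b}. X t \<in> carrier_mat m1 m2 \<and>
        (\<forall>i<m1. \<forall>j<m2.
           ((\<lambda>s. X s $$ (i, j)) has_real_derivative F (X t) t $$ (i, j)) (at t within {a..b})))"

definition orthonormal_cols :: "real mat \<Rightarrow> bool" where
  "orthonormal_cols U \<longleftrightarrow> transpose_mat U * U = 1\<^sub>m (dim_col U)"

definition diag_of :: "real list \<Rightarrow> real mat" where
  "diag_of \<sigma> = mat_diag (length \<sigma>) (\<lambda>i. \<sigma> ! i)"

definition is_svd :: "real mat \<Rightarrow> real mat \<Rightarrow> real list \<Rightarrow> real mat \<Rightarrow> bool" where
  "is_svd A U \<sigma> V \<longleftrightarrow>
     U \<in> carrier_mat (dim_row A) (length \<sigma>) \<and> V \<in> carrier_mat (dim_col A) (length \<sigma>) \<and>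
     orthonormal_cols U \<and> orthonormal_cols V \<and>
     sorted_wrt (\<ge>) \<sigma> \<and> (\<forall>x\<in>set \<sigma>. x \<ge> 0) \<and>
     A = U * diag_of \<sigma> * transpose_mat V"

definition is_reduced_svd :: "real mat \<Rightarrow> real mat \<Rightarrow> real list \<Rightarrow> real mat \<Rightarrow> bool" where
  "is_reduced_svd A U \<sigma> V \<longleftrightarrow> is_svd A U \<sigma> V \<and> (\<forall>x\<in>set \<sigma>. x > 0)"

(* With 0-based indices, keeping s triplets leaves the tail {s..<length \<sigma>}. *)
definition trunc_rank :: "real \<Rightarrow> real list \<Rightarrow> nat" where
  "trunc_rank \<epsilon> \<sigma> = (LEAST s. sqrt (\<Sum>j\<in>{s..<length \<sigma>}. (\<sigma> ! j)\<^sup>2) \<le> \<epsilon>)"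

definition leading_cols :: "nat \<Rightarrow> real mat \<Rightarrow> real mat" where
  "leading_cols s U = mat_of_cols (dim_row U) (take s (cols U))"

(* A relation rather than a function: the SVD, and in the case of repeated singular values even
   the truncated matrix, is not unique. Any choice of the reduced SVD is admitted. *)
definition is_truncated_svd :: "real \<Rightarrow> real mat \<Rightarrow> real mat \<Rightarrow> real list \<Rightarrow> real mat \<Rightarrow> bool" where
  "is_truncated_svd \<epsilon> A P \<tau> Q \<longleftrightarrow>
     (\<exists>U \<sigma> V. is_reduced_svd A U \<sigma> V \<and>
        (let s = trunc_rank \<epsilon> \<sigma>
         in P = leading_cols s U \<and> \<tau> = take s \<sigma> \<and> Q = leading_cols s V))"

definition orthonormal_basis_of_concat :: "nat \<Rightarrow> real mat \<Rightarrow> real mat \<Rightarrow> real mat \<Rightarrow> bool" where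
  "orthonormal_basis_of_concat m W U U' \<longleftrightarrow>
     dim_row W = m \<and> orthonormal_cols W \<and>
     vec_space.col_space m W = vec_space.col_space m (mat_of_cols m (cols U @ cols U'))"

(* Y is an output of one step of size dt from time tn, started at X = U diag(\<sigma>) V^T; the
   singular values of X enter the scheme only through X itself. The relation admits every choice
   of SVDs and bases, and every solution S of the Galerkin equation. *)
definition cheap_prediction_step ::
  "nat \<Rightarrow> nat \<Rightarrow> (real mat \<Rightarrow> real \<Rightarrow> real mat) \<Rightarrow> real \<Rightarrow> real \<Rightarrow> real \<Rightarrow> real
    \<Rightarrow> real mat \<Rightarrow> real mat \<Rightarrow> real mat \<Rightarrow> real mat \<Rightarrow> bool" where
  "cheap_prediction_step m1 m2 F \<epsilon>1 \<epsilon>2 tn dt U V X Y \<longleftrightarrow>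
     (\<exists>U' \<tau> V' Ut Vt S P \<rho> Q.
        is_truncated_svd \<epsilon>1 (F X tn) U' \<tau> V' \<and>
        orthonormal_basis_of_concat m1 Ut U U' \<and>
        orthonormal_basis_of_concat m2 Vt V V' \<and>
        S \<in> carrier_mat (dim_col Ut) (dim_col Vt) \<and>
        S = transpose_mat Ut * (X + dt \<cdot>\<^sub>m F (Ut * S * transpose_mat Vt) (tn + dt)) * Vt \<and>
        is_truncated_svd \<epsilon>2 S P \<rho> Q \<and>
        Y = Ut * (P * diag_of \<rho> * transpose_mat Q) * transpose_mat Vt)"

end

theory Submission
  imports Defs "HOL-Analysis.L2_Norm"
begin

text \<open>Both the exact solution and the Galerkin solution are compared with the explicit Euler step
  \<open>X + \<Delta>t F(X, t)\<close>. For the exact solution the difference is second order because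
  \<open>F\<close> is Lipschitz along a solution of speed at most \<open>B\<close>. The Galerkin solution is
  \<open>P\<^sub>1 (X + \<Delta>t E) P\<^sub>2\<close> for the orthogonal projections onto the two bases
  and \<open>E\<close> the right-hand side at the new time. These projections are nonexpansive in the
  Frobenius norm and fix \<open>X\<close> and the truncated right-hand side, so they change
  \<open>F(X, t)\<close> by at most \<open>2 \<epsilon>\<^sub>1\<close>; and \<open>E\<close> differs from \<open>F(X, t)\<close> by
  at most \<open>L (B + 1) \<Delta>t\<close>. The final truncation is an isometric image of a truncated SVD
  and costs \<open>\<epsilon>\<^sub>2\<close>.\<close>

section \<open>Frobenius norm and inner product\<close>

text \<open>The trace inner product tr(A^T B). Both index ranges are read off the first argument, so
  it is meant for matrices of equal dimensions.\<close>

definition frob_inner :: "real mat \<Rightarrow> real mat \<Rightarrow> real" where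
  "frob_inner A B = (\<Sum>i<dim_row A. \<Sum>j<dim_col A. A $$ (i, j) * B $$ (i, j))"

text \<open>Flattens the double sum to index pairs, so that the triangle and Cauchy-Schwarz
  inequalities can be taken over from \<open>L2_set\<close>.\<close>

lemma frob_norm_L2_set:
  assumes "A \<in> carrier_mat m n"
  shows "frob_norm A = L2_set (\<lambda>p. A $$ p) ({..<m} \<times> {..<n})"
  using assms by (simp add: frob_norm_def L2_set_def sum.cartesian_product case_prod_unfold)

lemma frob_norm_nonneg [simp]: "0 \<le> frob_norm A"
  by (simp add: frob_norm_def sum_nonneg)

lemma frob_norm_zero [simp]: "frob_norm (0\<^sub>m m n) = 0"
  by (simp add: frob_norm_def)

lemma frob_norm_transpose [simp]: "frob_norm (A\<^sup>T) = frob_norm A"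
  unfolding frob_norm_def by (simp, rule sum.swap)

lemma frob_norm_smult: "frob_norm (c \<cdot>\<^sub>m A) = \<bar>c\<bar> * frob_norm A"
  by (simp add: frob_norm_def power_mult_distrib real_sqrt_mult flip: sum_distrib_left)

lemma frob_inner_self: "frob_inner A A = (frob_norm A)\<^sup>2"
  by (simp add: frob_inner_def frob_norm_def sum_nonneg power2_eq_square)

lemma frob_norm_add_le:
  assumes "A \<in> carrier_mat m n" "B \<in> carrier_mat m n"
  shows "frob_norm (A + B) \<le> frob_norm A + frob_norm B"
proof -
  have "frob_norm (A + B) = L2_set (\<lambda>p. A $$ p + B $$ p) ({..<m} \<times> {..<n})"
    using assms by (auto simp: frob_norm_L2_set[of _ m n] intro!: L2_set_cong)
  then show ?thesis
    using L2_set_triangle_ineq[of "\<lambda>p. A $$ p" "\<lambda>p. B $$ p"] assms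
    by (simp add: frob_norm_L2_set[of _ m n])
qed

lemma frob_norm_minus_commute:
  assumes "A \<in> carrier_mat m n" "B \<in> carrier_mat m n"
  shows "frob_norm (A - B) = frob_norm (B - A)"
proof -
  have "A - B = (-1) \<cdot>\<^sub>m (B - A)"
    using assms by (intro eq_matI) auto
  then show ?thesis by (simp add: frob_norm_smult)
qed

lemma frob_norm_diff_triangle_le:
  assumes "A \<in> carrier_mat m n" "B \<in> carrier_mat m n" "C \<in> carrier_mat m n"
    and "frob_norm (A - B) \<le> a" "frob_norm (B - C) \<le> b"
  shows "frob_norm (A - C) \<le> a + b"
proof -
  have "A - C = (A - B) + (B - C)"
    using assms by (intro eq_matI) auto
  then show ?thesis
    using frob_norm_add_le[of "A - B" m n "B - C"] assms by (simp add: minus_carrier_mat)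
qed

text \<open>Cauchy-Schwarz, applied to the matrices as vectors indexed by pairs.\<close>

lemma frob_inner_le:
  assumes "A \<in> carrier_mat m n" "B \<in> carrier_mat m n"
  shows "frob_inner A B \<le> frob_norm A * frob_norm B"
proof -
  have "frob_inner A B = (\<Sum>p\<in>{..<m} \<times> {..<n}. A $$ p * B $$ p)"
    using assms by (simp add: frob_inner_def sum.cartesian_product case_prod_unfold)
  also have "\<dots> \<le> (\<Sum>p\<in>{..<m} \<times> {..<n}. \<bar>A $$ p\<bar> * \<bar>B $$ p\<bar>)"
    by (intro sum_mono) (metis abs_ge_self abs_mult)
  also have "\<dots> \<le> frob_norm A * frob_norm B"
    using assms by (simp add: frob_norm_L2_set[of _ m n] L2_set_mult_ineq)
  finally show ?thesis .
qed

text \<open>Left multiplication by \<open>U\<close> and by its transpose are adjoint: both sides are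
  the same triple sum, and the swaps reverse the order of summation from i, j, k to k, j, i.\<close>

lemma frob_inner_mult_left:
  assumes "U \<in> carrier_mat m n" "A \<in> carrier_mat n l" "B \<in> carrier_mat m l"
  shows "frob_inner (U * A) B = frob_inner A (U\<^sup>T * B)"
proof -
  have "frob_inner (U * A) B
      = (\<Sum>i<m. \<Sum>j<l. \<Sum>k<n. U $$ (i, k) * A $$ (k, j) * B $$ (i, j))"
    using assms
    by (simp add: frob_inner_def scalar_prod_def sum_distrib_right lessThan_atLeast0)
  also have "\<dots> = (\<Sum>j<l. \<Sum>i<m. \<Sum>k<n. U $$ (i, k) * A $$ (k, j) * B $$ (i, j))"
    by (rule sum.swap)
  also have "\<dots> = (\<Sum>j<l. \<Sum>k<n. \<Sum>i<m. U $$ (i, k) * A $$ (k, j) * B $$ (i, j))"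
    by (intro sum.cong refl sum.swap)
  also have "\<dots> = (\<Sum>k<n. \<Sum>j<l. \<Sum>i<m. U $$ (i, k) * A $$ (k, j) * B $$ (i, j))"
    by (rule sum.swap)
  also have "\<dots> = frob_inner A (U\<^sup>T * B)"
    using assms
    by (simp add: frob_inner_def scalar_prod_def sum_distrib_left lessThan_atLeast0 mult_ac)
  finally show ?thesis .
qed

section \<open>Isometries and contractions from orthonormal columns\<close>

lemma orthonormal_cols_mult_cancel:
  assumes "orthonormal_cols U" "U \<in> carrier_mat m r" "A \<in> carrier_mat r n"
  shows "U\<^sup>T * (U * A) = A"
proof -
  have "U\<^sup>T * (U * A) = U\<^sup>T * U * A"
    using assms(2,3) by (intro assoc_mult_mat[symmetric]) auto
  with assms show ?thesis
    by (auto simp: orthonormal_cols_def)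
qed

text \<open>By adjointness the squared norm of \<open>U * A\<close> is the inner product of
  \<open>A\<close> with U^T U A = A.\<close>

lemma frob_norm_orthonormal_mult:
  assumes "orthonormal_cols U" "U \<in> carrier_mat m r" "A \<in> carrier_mat r n"
  shows "frob_norm (U * A) = frob_norm A"
proof -
  have "(frob_norm (U * A))\<^sup>2 = (frob_norm A)\<^sup>2"
    using frob_inner_mult_left[of U m r A n "U * A"] orthonormal_cols_mult_cancel[OF assms] assms
    by (simp add: frob_inner_self)
  then show ?thesis by simp
qed

text \<open>For C = U^T A, adjointness and Cauchy-Schwarz give |C|^2 = <U C, A> \<le> |U C| |A| =
  |C| |A|; a nonzero factor |C| is then cancelled.\<close>

lemma frob_norm_transpose_orthonormal_mult_le:
  assumes "orthonormal_cols U" "U \<in> carrier_mat m r" "A \<in> carrier_mat m n"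
  shows "frob_norm (U\<^sup>T * A) \<le> frob_norm A"
proof -
  let ?C = "U\<^sup>T * A"
  have "(frob_norm ?C)\<^sup>2 = frob_inner (U * ?C) A"
    using frob_inner_mult_left[of U m r ?C n A] assms by (simp add: frob_inner_self)
  also have "\<dots> \<le> frob_norm (U * ?C) * frob_norm A"
    using assms by (intro frob_inner_le[of _ m n]) auto
  also have "\<dots> = frob_norm ?C * frob_norm A"
    using assms by (subst frob_norm_orthonormal_mult[of U m r _ n]) auto
  finally have "frob_norm ?C * frob_norm ?C \<le> frob_norm ?C * frob_norm A"
    by (simp add: power2_eq_square)
  then show ?thesis
    by (cases "frob_norm ?C = 0") (auto simp: order_less_le)
qed

lemma frob_norm_mult_transpose_orthonormal:
  assumes "orthonormal_cols V" "V \<in> carrier_mat n r" "A \<in> carrier_mat m r"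
  shows "frob_norm (A * V\<^sup>T) = frob_norm A"
proof -
  have "(A * V\<^sup>T)\<^sup>T = V * A\<^sup>T"
    using assms by (simp add: transpose_mult[of A m r "V\<^sup>T" n])
  then have "frob_norm (A * V\<^sup>T) = frob_norm (V * A\<^sup>T)"
    by (metis frob_norm_transpose)
  then show ?thesis
    using frob_norm_orthonormal_mult[OF assms(1,2), of "A\<^sup>T" m] assms by simp
qed

lemma frob_norm_mult_orthonormal_le:
  assumes "orthonormal_cols V" "V \<in> carrier_mat n r" "A \<in> carrier_mat m n"
  shows "frob_norm (A * V) \<le> frob_norm A"
proof -
  have "(A * V)\<^sup>T = V\<^sup>T * A\<^sup>T"
    using assms by (simp add: transpose_mult[of A m n V r])
  then have "frob_norm (A * V) = frob_norm (V\<^sup>T * A\<^sup>T)"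
    by (metis frob_norm_transpose)
  then show ?thesis
    using frob_norm_transpose_orthonormal_mult_le[OF assms(1,2), of "A\<^sup>T" m] assms by simp
qed

section \<open>Projection onto a pair of column spaces\<close>

text \<open>For orthonormal columns this is the orthogonal projection onto matrices of the form U S
  V^T. The bracketing isolates the coefficient matrix, as in the Galerkin equation.\<close>

definition two_sided_proj :: "real mat \<Rightarrow> real mat \<Rightarrow> real mat \<Rightarrow> real mat" where
  "two_sided_proj U V A = U * (U\<^sup>T * A * V) * V\<^sup>T"

lemma two_sided_proj_carrier [simp]:
  assumes "U \<in> carrier_mat m r" "V \<in> carrier_mat n s"
  shows "two_sided_proj U V A \<in> carrier_mat m n"
  using assms by (intro carrier_matI) (auto simp: two_sided_proj_def)

lemma frob_norm_two_sided:
  assumes "orthonormal_cols U" "U \<in> carrier_mat m r" "orthonormal_cols V" "V \<in> carrier_mat n s"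
    and "A \<in> carrier_mat r s"
  shows "frob_norm (U * A * V\<^sup>T) = frob_norm A"
  using assms
  by (simp add: frob_norm_mult_transpose_orthonormal[of V n s _ m] frob_norm_orthonormal_mult[of U m r]
      del: assoc_mult_mat)

text \<open>The outer factors preserve the norm of the coefficient matrix, and passing to the
  coefficients does not increase the norm.\<close>

lemma frob_norm_two_sided_proj_le:
  assumes "orthonormal_cols U" "U \<in> carrier_mat m r" "orthonormal_cols V" "V \<in> carrier_mat n s"
    and "A \<in> carrier_mat m n"
  shows "frob_norm (two_sided_proj U V A) \<le> frob_norm A"
proof -
  have "frob_norm (two_sided_proj U V A) = frob_norm (U\<^sup>T * A * V)"
    unfolding two_sided_proj_def using assms by (intro frob_norm_two_sided) auto
  also have "\<dots> \<le> frob_norm (U\<^sup>T * A)"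
    using assms by (intro frob_norm_mult_orthonormal_le[of V n s _ r]) auto
  also have "\<dots> \<le> frob_norm A"
    using assms by (intro frob_norm_transpose_orthonormal_mult_le) auto
  finally show ?thesis .
qed

lemma two_sided_proj_add:
  assumes "U \<in> carrier_mat m r" "V \<in> carrier_mat n s"
    and "A \<in> carrier_mat m n" "B \<in> carrier_mat m n"
  shows "two_sided_proj U V (A + B) = two_sided_proj U V A + two_sided_proj U V B"
  unfolding two_sided_proj_def
  using assms
  by (simp add: mult_add_distrib_mat[of "U\<^sup>T" r m _ n] add_mult_distrib_mat[of _ r n]
      mult_add_distrib_mat[of U m r _ s] add_mult_distrib_mat[of _ m s]
      mult_carrier_mat[of "U\<^sup>T" r m _ n] mult_carrier_mat[of _ r n V s] del: assoc_mult_mat)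

lemma two_sided_proj_smult:
  assumes "U \<in> carrier_mat m r" "V \<in> carrier_mat n s" "A \<in> carrier_mat m n"
  shows "two_sided_proj U V (c \<cdot>\<^sub>m A) = c \<cdot>\<^sub>m two_sided_proj U V A"
  unfolding two_sided_proj_def
  using assms
  by (simp add: mult_smult_distrib[of "U\<^sup>T" r m _ n] mult_smult_assoc_mat[of _ r n]
      mult_smult_distrib[of U m r _ s] mult_smult_assoc_mat[of _ m s]
      mult_carrier_mat[of "U\<^sup>T" r m _ n] mult_carrier_mat[of _ r n V s] del: assoc_mult_mat)

lemma two_sided_proj_diff:
  assumes "U \<in> carrier_mat m r" "V \<in> carrier_mat n s"
    and "A \<in> carrier_mat m n" "B \<in> carrier_mat m n"
  shows "two_sided_proj U V (A - B) = two_sided_proj U V A - two_sided_proj U V B"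
proof -
  have eq: "C - D = C + (-1) \<cdot>\<^sub>m D"
    if "C \<in> carrier_mat m n" "D \<in> carrier_mat m n" for C D :: "real mat"
    using that by (intro eq_matI) auto
  show ?thesis
    using assms
    by (simp add: eq two_sided_proj_add[of U m r V n s] two_sided_proj_smult[of U m r V n s])
qed

text \<open>With equations between dimensions as premises, every variable of the rule occurs in its
  left-hand side, so it works as a rewrite rule.\<close>

lemma assoc_mult_mat_dim:
  assumes "dim_col A = dim_row B" "dim_col B = dim_row C"
  shows "(A :: 'a :: semiring_0 mat) * B * C = A * (B * C)"
  using assms by (intro assoc_mult_mat[of A "dim_row A" "dim_row B" B "dim_row C" C "dim_col C"]) auto

text \<open>Reassociation lets U U^T meet \<open>P\<close> and V V^T meet the transpose of
  \<open>Q\<close>; the last two premises say that each is left unchanged.\<close>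

lemma two_sided_proj_fixes:
  assumes "U \<in> carrier_mat m r" "V \<in> carrier_mat n s"
    and "P \<in> carrier_mat m p" "D \<in> carrier_mat p q" "Q \<in> carrier_mat n q"
    and P: "U * (U\<^sup>T * P) = P" and Q: "V * (V\<^sup>T * Q) = Q"
  shows "two_sided_proj U V (P * D * Q\<^sup>T) = P * D * Q\<^sup>T"
proof -
  have dims: "dim_row U = m" "dim_col U = r" "dim_row V = n" "dim_col V = s" "dim_row P = m"
    "dim_col P = p" "dim_row D = p" "dim_col D = q" "dim_row Q = n" "dim_col Q = q"
    using assms(1-5) by auto
  have "(V * (V\<^sup>T * Q))\<^sup>T = Q\<^sup>T * V * V\<^sup>T"
    using assms(2,5) by (simp add: transpose_mult[of V n s _ q] transpose_mult[of "V\<^sup>T" s n Q q]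
        del: assoc_mult_mat)
  with Q have QT: "Q\<^sup>T * V * V\<^sup>T = Q\<^sup>T"
    by simp
  have "two_sided_proj U V (P * D * Q\<^sup>T) = (U * (U\<^sup>T * P)) * D * (Q\<^sup>T * V * V\<^sup>T)"
    by (simp add: two_sided_proj_def assoc_mult_mat_dim dims del: assoc_mult_mat)
  then show ?thesis
    by (simp only: P QT)
qed

section \<open>Bases of the merged column spaces\<close>

text \<open>W W^T is the identity on the column space of \<open>W\<close>, because W^T W = 1. This
  space is the span of the columns of \<open>U\<close> and \<open>U'\<close>, so both matrices are
  fixed.\<close>

lemma orthonormal_basis_of_concatD:
  assumes "orthonormal_basis_of_concat m W U U'"
    and "U \<in> carrier_mat m r" "U' \<in> carrier_mat m r'"
  shows "W \<in> carrier_mat m (dim_col W)" "orthonormal_cols W"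
    "W * (W\<^sup>T * U) = U" "W * (W\<^sup>T * U') = U'"
proof -
  show W: "W \<in> carrier_mat m (dim_col W)" and o: "orthonormal_cols W"
    using assms(1) by (auto simp: orthonormal_basis_of_concat_def)
  define d where "d = dim_col W"
  have Wd: "W \<in> carrier_mat m d" and Wo: "W\<^sup>T * W = 1\<^sub>m d"
    using W o by (simp_all only: d_def orthonormal_cols_def)
  interpret vec_space "TYPE(real)" m .
  let ?M = "mat_of_cols m (cols U @ cols U')"
  have sub: "set (cols U) \<subseteq> carrier_vec m" "set (cols U') \<subseteq> carrier_vec m"
    using assms(2,3) cols_dim by blast+
  then have S: "set (cols U @ cols U') \<subseteq> carrier_vec m"
    by auto
  have "col_space W = col_space ?M"
    using assms(1) unfolding orthonormal_basis_of_concat_def by blast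
  also have "\<dots> = span (set (cols U @ cols U'))"
    unfolding col_space_def cols_mat_of_cols[OF S] ..
  finally have "set (cols U @ cols U') \<subseteq> col_space W"
    using in_own_span[OF S] by (simp only:)
  moreover have "W *\<^sub>v (W\<^sup>T *\<^sub>v u) = u" if "u \<in> col_space W" for u
  proof -
    obtain x where x: "x \<in> carrier_vec d" "u = W *\<^sub>v x"
      using \<open>u \<in> col_space W\<close>[unfolded col_space_eq[OF W]] by (auto simp: d_def)
    have "W\<^sup>T *\<^sub>v (W *\<^sub>v x) = W\<^sup>T * W *\<^sub>v x"
      using Wd x(1) by (intro assoc_mult_mat_vec[symmetric]) auto
    then have "W\<^sup>T *\<^sub>v (W *\<^sub>v x) = x"
      unfolding Wo using x(1) by simp
    then show ?thesis
      by (simp only: x(2))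
  qed
  ultimately have fixed: "W *\<^sub>v (W\<^sup>T *\<^sub>v u) = u" if "u \<in> set (cols U) \<union> set (cols U')" for u
    using that by auto
  \<comment> \<open>The vector identity is lifted column by column, for a general \<open>A\<close>
    in order to cover \<open>U\<close> and \<open>U'\<close> at once.\<close>
  have "W * (W\<^sup>T * A) = A" if "A \<in> carrier_mat m q" "set (cols A) \<subseteq> set (cols U) \<union> set (cols U')" for A q
  proof (rule mat_col_eqI)
    fix j assume j: "j < dim_col A"
    then have colA: "col A j \<in> set (cols U) \<union> set (cols U')"
      using that(2) nth_mem[of j "cols A"] by auto
    have WA: "W\<^sup>T * A \<in> carrier_mat d q" and WT: "W\<^sup>T \<in> carrier_mat d m" and "j < q"
      using that(1) j Wd by auto
    have "col (W * (W\<^sup>T * A)) j = W *\<^sub>v (W\<^sup>T *\<^sub>v col A j)"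
      unfolding col_mult2[OF Wd WA \<open>j < q\<close>] col_mult2[OF WT that(1) \<open>j < q\<close>] ..
    with fixed[OF colA] show "col (W * (W\<^sup>T * A)) j = col A j"
      by (simp only:)
  qed (use that Wd in auto)
  then show "W * (W\<^sup>T * U) = U" "W * (W\<^sup>T * U') = U'"
    using assms(2,3) by blast+
qed

section \<open>Error of the truncated SVD\<close>

text \<open>The expansion into rank-one terms, read entrywise; truncating an SVD then means cutting
  off this sum.\<close>

lemma svd_form_index:
  assumes "U \<in> carrier_mat m (length \<sigma>)" "V \<in> carrier_mat n (length \<sigma>)" "i < m" "j < n"
  shows "(U * diag_of \<sigma> * V\<^sup>T) $$ (i, j)
    = (\<Sum>k<length \<sigma>. U $$ (i, k) * \<sigma> ! k * V $$ (j, k))"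
proof -
  have "U * diag_of \<sigma> = mat m (length \<sigma>) (\<lambda>(i, k). U $$ (i, k) * \<sigma> ! k)"
    using assms(1) by (simp add: diag_of_def mat_diag_mult_right[of _ m])
  then show ?thesis
    using assms by (simp add: scalar_prod_def lessThan_atLeast0)
qed

lemma leading_cols_carrier:
  assumes "U \<in> carrier_mat m r" "s \<le> r"
  shows "leading_cols s U \<in> carrier_mat m s"
  using assms by (intro carrier_matI) (auto simp: leading_cols_def)

lemma leading_cols_index:
  assumes "U \<in> carrier_mat m r" "s \<le> r" "i < m" "k < s"
  shows "leading_cols s U $$ (i, k) = U $$ (i, k)"
  using assms by (simp add: leading_cols_def mat_of_cols_index)

text \<open>Keeping all triplets leaves an empty tail of norm 0, so \<open>length \<sigma>\<close>
  is admissible and the least admissible rank exists.\<close>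

lemma trunc_rank:
  assumes "0 \<le> \<epsilon>"
  shows "trunc_rank \<epsilon> \<sigma> \<le> length \<sigma>"
    and "sqrt (\<Sum>j\<in>{trunc_rank \<epsilon> \<sigma>..<length \<sigma>}. (\<sigma> ! j)\<^sup>2) \<le> \<epsilon>"
proof -
  let ?P = "\<lambda>s. sqrt (\<Sum>j\<in>{s..<length \<sigma>}. (\<sigma> ! j)\<^sup>2) \<le> \<epsilon>"
  have P: "?P (length \<sigma>)"
    using assms by simp
  show "trunc_rank \<epsilon> \<sigma> \<le> length \<sigma>"
    unfolding trunc_rank_def using P by (rule Least_le[of ?P])
  show "?P (trunc_rank \<epsilon> \<sigma>)"
    unfolding trunc_rank_def using P by (rule LeastI[of ?P])
qed

lemma frob_norm_mat_diag: "frob_norm (mat_diag n f) = sqrt (\<Sum>k<n. (f k)\<^sup>2)"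
proof -
  have "(\<Sum>j<n. (mat_diag n f $$ (i, j))\<^sup>2) = (f i)\<^sup>2" if "i < n" for i
  proof -
    have "(\<Sum>j<n. (mat_diag n f $$ (i, j))\<^sup>2) = (\<Sum>j<n. if i = j then (f j)\<^sup>2 else 0)"
      using that by (intro sum.cong) (auto simp: mat_diag_def)
    with that show ?thesis by simp
  qed
  moreover have "dim_row (mat_diag n f) = n" "dim_col (mat_diag n f) = n"
    by (simp_all add: mat_diag_def)
  ultimately show ?thesis
    by (simp add: frob_norm_def)
qed

text \<open>The discarded part is an SVD form with the same \<open>U\<close> and \<open>V\<close>
  and the leading \<open>s\<close> singular values set to 0; by isometry its norm is that of the
  tail.\<close>

lemma is_truncated_svdD:
  assumes "is_truncated_svd \<epsilon> A P \<tau> Q" "0 \<le> \<epsilon>" "A \<in> carrier_mat m n"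
  shows "P \<in> carrier_mat m (length \<tau>)" "Q \<in> carrier_mat n (length \<tau>)"
    and "frob_norm (A - P * diag_of \<tau> * Q\<^sup>T) \<le> \<epsilon>"
proof -
  obtain U \<sigma> V where svd: "is_svd A U \<sigma> V"
    and PQ: "P = leading_cols (trunc_rank \<epsilon> \<sigma>) U" "Q = leading_cols (trunc_rank \<epsilon> \<sigma>) V"
    and \<tau>: "\<tau> = take (trunc_rank \<epsilon> \<sigma>) \<sigma>"
    using assms(1) by (auto simp: is_truncated_svd_def is_reduced_svd_def Let_def)
  define s where "s = trunc_rank \<epsilon> \<sigma>"
  have s: "s \<le> length \<sigma>" "sqrt (\<Sum>j\<in>{s..<length \<sigma>}. (\<sigma> ! j)\<^sup>2) \<le> \<epsilon>"
    using trunc_rank[OF assms(2)] by (simp_all add: s_def)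
  have U: "U \<in> carrier_mat m (length \<sigma>)" "orthonormal_cols U"
    and V: "V \<in> carrier_mat n (length \<sigma>)" "orthonormal_cols V"
    and A: "A = U * diag_of \<sigma> * V\<^sup>T"
    using svd assms(3) by (auto simp: is_svd_def)
  have len: "length \<tau> = s"
    using s by (simp add: \<tau> s_def)
  show P: "P \<in> carrier_mat m (length \<tau>)" and Q: "Q \<in> carrier_mat n (length \<tau>)"
    unfolding len using leading_cols_carrier U V s by (auto simp: PQ simp flip: s_def)
  \<comment> \<open>Padding with zeros keeps the full length, so the original factors
    \<open>U\<close> and \<open>V\<close> fit.\<close>
  define tail where "tail = map (\<lambda>k. if k < s then 0 else \<sigma> ! k) [0..<length \<sigma>]"
  have len_tail: "length tail = length \<sigma>"
    by (simp add: tail_def)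
  have "A - P * diag_of \<tau> * Q\<^sup>T = U * diag_of tail * V\<^sup>T"
  proof (rule eq_matI)
    fix i j assume "i < dim_row (U * diag_of tail * V\<^sup>T)" "j < dim_col (U * diag_of tail * V\<^sup>T)"
    then have ij: "i < m" "j < n" using U V by auto
    let ?f = "\<lambda>k. U $$ (i, k) * \<sigma> ! k * V $$ (j, k)"
    have "(P * diag_of \<tau> * Q\<^sup>T) $$ (i, j) = (\<Sum>k<s. ?f k)"
      using ij svd_form_index[OF P Q ij] leading_cols_index[OF U(1) s(1)]
        leading_cols_index[OF V(1) s(1)] s(1)
      by (simp add: len PQ \<tau> min_absorb2 flip: s_def)
    moreover have "A $$ (i, j) = (\<Sum>k<length \<sigma>. ?f k)"
      unfolding A using svd_form_index[OF U(1) V(1) ij] .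
    moreover have "(U * diag_of tail * V\<^sup>T) $$ (i, j) = (\<Sum>k<length \<sigma>. if k < s then 0 else ?f k)"
      using ij U V
      by (subst svd_form_index[of U m tail V n]) (auto simp: len_tail tail_def intro!: sum.cong)
    moreover have "\<dots> = (\<Sum>k\<in>{..<length \<sigma>} - {..<s}. ?f k)"
      by (rule sum.mono_neutral_cong_right) auto
    moreover have "\<dots> = (\<Sum>k<length \<sigma>. ?f k) - (\<Sum>k<s. ?f k)"
      using s by (intro sum_diff) auto
    ultimately show "(A - P * diag_of \<tau> * Q\<^sup>T) $$ (i, j) = (U * diag_of tail * V\<^sup>T) $$ (i, j)"
      using ij P Q by simp
  qed (use U V P Q in auto)
  then have "frob_norm (A - P * diag_of \<tau> * Q\<^sup>T) = frob_norm (diag_of tail)"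
    using U V by (simp add: frob_norm_two_sided[of U m "length \<sigma>" V n "length \<sigma>"]
        diag_of_def len_tail)
  also have "\<dots> = sqrt (\<Sum>k<length \<sigma>. if k < s then 0 else (\<sigma> ! k)\<^sup>2)"
    unfolding diag_of_def frob_norm_mat_diag len_tail
    by (intro arg_cong[where f = sqrt] sum.cong) (auto simp: tail_def)
  also have "\<dots> = sqrt (\<Sum>k\<in>{s..<length \<sigma>}. (\<sigma> ! k)\<^sup>2)"
    by (intro arg_cong[where f = sqrt] sum.mono_neutral_cong_right) auto
  finally show "frob_norm (A - P * diag_of \<tau> * Q\<^sup>T) \<le> \<epsilon>"
    using s by simp
qed

section \<open>Exact solution against the Euler step\<close>

text \<open>Mean value inequality: apply the scalar mean value theorem to the inner product of the
  solution with its own deviation from the linear path.\<close>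

lemma ode_solution_linear_error:
  assumes "ode_solution m n F a b X" "a < t" "t \<le> b" "K \<in> carrier_mat m n"
    and F: "\<And>s. s \<in> {a..t} \<Longrightarrow> F (X s) s \<in> carrier_mat m n"
    and M: "\<And>s. s \<in> {a..t} \<Longrightarrow> frob_norm (F (X s) s - K) \<le> M"
  shows "frob_norm (X t - (X a + (t - a) \<cdot>\<^sub>m K)) \<le> (t - a) * M"
proof -
  have X: "X s \<in> carrier_mat m n" if "s \<in> {a..t}" for s
    using assms(1,3) that by (auto simp: ode_solution_def)
  define D where "D = X t - (X a + (t - a) \<cdot>\<^sub>m K)"
  have D: "D \<in> carrier_mat m n"
    using assms(2,4) by (auto simp: D_def)
  \<comment> \<open>Inner product of X(s) - (s - a) K with the fixed matrix \<open>D\<close>; its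
    increment over [a, t] is <D, D>.\<close>
  define \<phi> where "\<phi> s = (\<Sum>i<m. \<Sum>j<n. (X s $$ (i, j) - (s - a) * K $$ (i, j)) * D $$ (i, j))" for s
  have der: "(\<phi> has_real_derivative frob_inner (F (X s) s - K) D) (at s within {a..t})"
    if "s \<in> {a..t}" for s
  proof -
    have "((\<lambda>s. X s $$ (i, j)) has_real_derivative F (X s) s $$ (i, j)) (at s within {a..t})"
      if "i < m" "j < n" for i j
      using assms(1,3) that \<open>s \<in> {a..t}\<close>
      by (auto simp: ode_solution_def intro: DERIV_subset[where s = "{a..b}"])
    then have "(\<phi> has_real_derivative
        (\<Sum>i<m. \<Sum>j<n. (F (X s) s $$ (i, j) - K $$ (i, j)) * D $$ (i, j))) (at s within {a..t})"
      unfolding \<phi>_def by (intro DERIV_sum) (auto intro!: derivative_eq_intros)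
    also have "(\<Sum>i<m. \<Sum>j<n. (F (X s) s $$ (i, j) - K $$ (i, j)) * D $$ (i, j))
        = frob_inner (F (X s) s - K) D"
      using assms(4) by (simp add: frob_inner_def)
    finally show ?thesis .
  qed
  obtain z where z: "a < z" "z < t" "\<phi> t - \<phi> a = frob_inner (F (X z) z - K) D * (t - a)"
  proof (rule mvt[of a t \<phi> "\<lambda>s h. frob_inner (F (X s) s - K) D * h"])
    show "continuous_on {a..t} \<phi>"
      using der by (rule DERIV_continuous_on)
    show "(\<phi> has_derivative (\<lambda>h. frob_inner (F (X s) s - K) D * h)) (at s)" if "a < s" "s < t" for s
      using der[of s] that by (simp add: has_field_derivative_def at_within_Icc_at)
  qed (use \<open>a < t\<close> in auto)
  have "(frob_norm D)\<^sup>2 = \<phi> t - \<phi> a"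
    using X[of t] X[of a] assms(2,4)
    by (simp add: frob_inner_def \<phi>_def flip: frob_inner_self sum_subtractf)
      (auto simp: D_def algebra_simps intro!: sum.cong)
  also have "\<dots> \<le> frob_norm (F (X z) z - K) * frob_norm D * (t - a)"
    unfolding z(3) using z assms(4) D by (intro mult_right_mono frob_inner_le[of _ m n]) auto
  also have "\<dots> \<le> M * frob_norm D * (t - a)"
    using z M[of z] by (intro mult_right_mono) auto
  finally have "frob_norm D * frob_norm D \<le> frob_norm D * ((t - a) * M)"
    by (simp add: power2_eq_square mult_ac)
  \<comment> \<open>\<open>M\<close> bounds a norm, hence is nonnegative; this settles the case in
    which |D| = 0 cannot be cancelled.\<close>
  moreover have "0 \<le> (t - a) * M"
    using order_trans[OF frob_norm_nonneg M[of a]] \<open>a < t\<close> by simp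
  ultimately have "frob_norm D \<le> (t - a) * M"
    by (cases "frob_norm D = 0") (auto simp: order_less_le)
  then show ?thesis
    by (simp add: D_def)
qed

lemma affine_rhs_carrier:
  assumes "G t \<in> carrier_mat m1 m2"
  shows "affine_rhs m1 m2 k A B G X t \<in> carrier_mat m1 m2"
  using assms by (simp add: affine_rhs_def)

text \<open>The solution moves by at most \<open>h * B\<close>, so by the Lipschitz condition its
  slope stays within \<open>L * (h * B) + L * h\<close> of the initial slope; integrating over
  length \<open>h\<close> gives second order.\<close>

lemma exact_euler_error:
  assumes sol: "ode_solution m n F a (a + h) X" and h: "0 < h"
    and car: "\<And>M t. M \<in> carrier_mat m n \<Longrightarrow> F M t \<in> carrier_mat m n"
    and lip: "\<And>M Z s t. M \<in> carrier_mat m n \<Longrightarrow> Z \<in> carrier_mat m n \<Longrightarrow>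
      frob_norm (F M s - F Z t) \<le> L * frob_norm (M - Z) + L * \<bar>s - t\<bar>"
    and bnd: "\<And>M t. M \<in> carrier_mat m n \<Longrightarrow> frob_norm (F M t) \<le> B"
    and "0 \<le> L" "0 \<le> B"
  shows "frob_norm (X (a + h) - (X a + h \<cdot>\<^sub>m F (X a) a)) \<le> L * (B + 1) * h\<^sup>2"
proof -
  have X: "X s \<in> carrier_mat m n" if "s \<in> {a..a + h}" for s
    using sol that by (auto simp: ode_solution_def)
  have diff_zero: "A - 0\<^sub>m m n = A" if "A \<in> carrier_mat m n" for A :: "real mat"
    using that by (intro eq_matI) auto
  \<comment> \<open>Comparison with the path of slope 0. The point \<open>s = a\<close> is treated
    apart because \<open>ode_solution_linear_error\<close> assumes a strict inequality.\<close>
  have growth: "frob_norm (X s - X a) \<le> h * B" if s: "s \<in> {a..a + h}" for s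
  proof (cases "s = a")
    case True
    then have "X s - X a = 0\<^sub>m m n"
      using X[of a] h by (intro eq_matI) auto
    then show ?thesis using \<open>0 \<le> B\<close> h by simp
  next
    case False
    have "frob_norm (X s - (X a + (s - a) \<cdot>\<^sub>m 0\<^sub>m m n)) \<le> (s - a) * B"
      using s False X car bnd by (intro ode_solution_linear_error[OF sol]) (auto simp: diff_zero)
    moreover have "X a + (s - a) \<cdot>\<^sub>m 0\<^sub>m m n = X a"
      using X[of a] h by (intro eq_matI) auto
    moreover have "(s - a) * B \<le> h * B"
      using s \<open>0 \<le> B\<close> by (intro mult_right_mono) auto
    ultimately show ?thesis by simp
  qed
  have "frob_norm (X (a + h) - (X a + (a + h - a) \<cdot>\<^sub>m F (X a) a)) \<le> (a + h - a) * (L * (h * B) + L * h)"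
  proof (rule ode_solution_linear_error[OF sol])
    fix s assume s: "s \<in> {a..a + h}"
    have "frob_norm (F (X s) s - F (X a) a) \<le> L * frob_norm (X s - X a) + L * \<bar>s - a\<bar>"
      using X s h by (intro lip) auto
    also have "\<dots> \<le> L * (h * B) + L * h"
      using growth[OF s] s \<open>0 \<le> L\<close> by (intro add_mono mult_left_mono) auto
    finally show "frob_norm (F (X s) s - F (X a) a) \<le> L * (h * B) + L * h" .
  qed (use X h car in auto)
  then show ?thesis
    by (simp add: power2_eq_square algebra_simps)
qed

section \<open>Galerkin step and final truncation\<close>

text \<open>The projection onto the Galerkin spaces fixes both the initial value and the truncated
  right-hand side, so it moves the Euler step by at most twice the truncation error.\<close>

lemma galerkin_euler_error:
  assumes W1: "W1 \<in> carrier_mat m r" "orthonormal_cols W1"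
    and W2: "W2 \<in> carrier_mat n s" "orthonormal_cols W2"
    and X: "X \<in> carrier_mat m n" "two_sided_proj W1 W2 X = X"
    and T: "T \<in> carrier_mat m n" "two_sided_proj W1 W2 T = T"
    and K: "K \<in> carrier_mat m n" "frob_norm (K - T) \<le> \<epsilon>"
    and E: "E \<in> carrier_mat m n" "frob_norm (K - E) \<le> d"
    and h: "0 \<le> h"
  shows "frob_norm ((X + h \<cdot>\<^sub>m K) - two_sided_proj W1 W2 (X + h \<cdot>\<^sub>m E)) \<le> 2 * h * \<epsilon> + h * d"
proof -
  let ?p = "two_sided_proj W1 W2"
  have p: "?p A \<in> carrier_mat m n" for A
    using W1 W2 by simp
  have contr: "frob_norm (?p A) \<le> frob_norm A" if "A \<in> carrier_mat m n" for A
    using W1 W2 that by (intro frob_norm_two_sided_proj_le) auto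
  have diff: "?p (A - C) = ?p A - ?p C" if "A \<in> carrier_mat m n" "C \<in> carrier_mat m n" for A C
    using W1 W2 that by (intro two_sided_proj_diff) auto
  have "?p (X + h \<cdot>\<^sub>m E) = X + h \<cdot>\<^sub>m ?p E"
    using W1 W2 X E by (simp add: two_sided_proj_add[of W1 m r W2 n s] two_sided_proj_smult[of W1 m r W2 n s])
  \<comment> \<open>The fixed part \<open>X\<close> cancels, and only the slopes \<open>K\<close>
    and \<open>?p E\<close> remain to be compared.\<close>
  then have "(X + h \<cdot>\<^sub>m K) - ?p (X + h \<cdot>\<^sub>m E) = h \<cdot>\<^sub>m (K - ?p E)"
    using X K p[of E] by (intro eq_matI) (auto simp: algebra_simps)
  then have "frob_norm ((X + h \<cdot>\<^sub>m K) - ?p (X + h \<cdot>\<^sub>m E)) = h * frob_norm (K - ?p E)"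
    using h by (simp add: frob_norm_smult)
  moreover have "frob_norm (T - ?p K) \<le> \<epsilon>"
    using contr[of "T - K"] diff[of T K] T K frob_norm_minus_commute[of T m n K]
    by (simp add: minus_carrier_mat)
  moreover have "frob_norm (?p K - ?p E) \<le> d"
    using contr[of "K - E"] diff[of K E] K E by (simp add: minus_carrier_mat)
  \<comment> \<open>The chain \<open>K\<close>, \<open>T\<close>, \<open>?p K\<close>,
    \<open>?p E\<close> costs \<open>\<epsilon>\<close>, \<open>\<epsilon>\<close> and
    \<open>d\<close>; its middle link is the projection of \<open>T - K\<close>, since
    \<open>T\<close> is fixed.\<close>
  ultimately have "frob_norm (K - ?p E) \<le> \<epsilon> + \<epsilon> + d"
    using K(1,2) T(1) p by (intro frob_norm_diff_triangle_le[of K m n "?p K"]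
        frob_norm_diff_triangle_le[of K m n T]) auto
  with h have "h * frob_norm (K - ?p E) \<le> h * (\<epsilon> + \<epsilon> + d)"
    by (intro mult_left_mono)
  with \<open>frob_norm ((X + h \<cdot>\<^sub>m K) - ?p (X + h \<cdot>\<^sub>m E)) = h * frob_norm (K - ?p E)\<close> show ?thesis
    by (simp add: algebra_simps)
qed

text \<open>Every solution of the implicit equation is a projected step Z = p(X + h E) with E = F(Z,
  a + h). Boundedness of \<open>F\<close> keeps \<open>Z\<close> within \<open>h * B\<close> of
  \<open>X\<close>, and the Lipschitz condition then keeps \<open>E\<close> close to F(X,
  a).\<close>

lemma cheap_prediction_step_error:
  assumes step: "cheap_prediction_step m n F \<epsilon>1 \<epsilon>2 a h U V X Y"
    and X: "X \<in> carrier_mat m n" "is_svd X U \<sigma> V" and h: "0 < h"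
    and car: "\<And>M t. M \<in> carrier_mat m n \<Longrightarrow> F M t \<in> carrier_mat m n"
    and lip: "\<And>M Z s t. M \<in> carrier_mat m n \<Longrightarrow> Z \<in> carrier_mat m n \<Longrightarrow>
      frob_norm (F M s - F Z t) \<le> L * frob_norm (M - Z) + L * \<bar>s - t\<bar>"
    and bnd: "\<And>M t. M \<in> carrier_mat m n \<Longrightarrow> frob_norm (F M t) \<le> B"
    and "0 \<le> L" "0 \<le> \<epsilon>1" "0 \<le> \<epsilon>2"
  shows "Y \<in> carrier_mat m n"
    and "frob_norm ((X + h \<cdot>\<^sub>m F X a) - Y) \<le> L * (B + 1) * h\<^sup>2 + 2 * h * \<epsilon>1 + \<epsilon>2"
proof -
  obtain U' \<tau> V' W1 W2 S P \<rho> Q where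
    tr1: "is_truncated_svd \<epsilon>1 (F X a) U' \<tau> V'"
    and b1: "orthonormal_basis_of_concat m W1 U U'" and b2: "orthonormal_basis_of_concat n W2 V V'"
    and S: "S \<in> carrier_mat (dim_col W1) (dim_col W2)"
    and S_eq: "S = W1\<^sup>T * (X + h \<cdot>\<^sub>m F (W1 * S * W2\<^sup>T) (a + h)) * W2"
    and tr2: "is_truncated_svd \<epsilon>2 S P \<rho> Q"
    and Y: "Y = W1 * (P * diag_of \<rho> * Q\<^sup>T) * W2\<^sup>T"
    using step unfolding cheap_prediction_step_def by blast
  note T = is_truncated_svdD[OF tr1 \<open>0 \<le> \<epsilon>1\<close> car[OF X(1)]]
  note S' = is_truncated_svdD[OF tr2 \<open>0 \<le> \<epsilon>2\<close> S]
  have U: "U \<in> carrier_mat m (length \<sigma>)" and V: "V \<in> carrier_mat n (length \<sigma>)"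
    and X_eq: "X = U * diag_of \<sigma> * V\<^sup>T"
    using X by (auto simp: is_svd_def)
  note W1 = orthonormal_basis_of_concatD[OF b1 U T(1)]
  note W2 = orthonormal_basis_of_concatD[OF b2 V T(2)]
  define r s where "r = dim_col W1" and "s = dim_col W2"
  have W1c: "W1 \<in> carrier_mat m r" and W2c: "W2 \<in> carrier_mat n s"
    unfolding r_def s_def by (rule W1(1), rule W2(1))
  define Z where "Z = W1 * S * W2\<^sup>T"
  have Z: "Z \<in> carrier_mat m n"
    using W1c W2c by (intro carrier_matI) (auto simp: Z_def)
  define E where "E = F Z (a + h)"
  have E: "E \<in> carrier_mat m n"
    using Z by (simp add: E_def car)
  have diag: "diag_of xs \<in> carrier_mat (length xs) (length xs)" for xs
    by (simp add: diag_of_def)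
  let ?p = "two_sided_proj W1 W2"
  have pX: "?p X = X"
    unfolding X_eq using two_sided_proj_fixes[OF W1(1) W2(1) U diag V W1(3) W2(3)] .
  \<comment> \<open>The Galerkin equation for \<open>S\<close>, multiplied by \<open>W1\<close> on
    the left and by the transpose of \<open>W2\<close> on the right.\<close>
  have Z_eq: "Z = ?p (X + h \<cdot>\<^sub>m E)"
    using S_eq by (simp add: two_sided_proj_def E_def Z_def)
  have "X - Z = - (h \<cdot>\<^sub>m ?p E)"
    unfolding Z_eq using W1c W2c X E pX two_sided_proj_carrier[OF W1c W2c, of E]
    by (intro eq_matI)
      (auto simp: two_sided_proj_add[of W1 m r W2 n s] two_sided_proj_smult[of W1 m r W2 n s])
  also have "\<dots> = (- h) \<cdot>\<^sub>m ?p E"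
    by (intro eq_matI) auto
  finally have "frob_norm (X - Z) = h * frob_norm (?p E)"
    using h by (simp add: frob_norm_smult)
  also have "\<dots> \<le> h * B"
    using order_trans[OF frob_norm_two_sided_proj_le[OF W1(2,1) W2(2,1) E] bnd[OF Z, of "a + h", folded E_def]] h
    by (intro mult_left_mono) auto
  finally have XZ: "frob_norm (X - Z) \<le> h * B" .
  have "frob_norm (F X a - E) \<le> L * frob_norm (X - Z) + L * \<bar>a - (a + h)\<bar>"
    unfolding E_def using X(1) Z by (rule lip)
  also have "\<dots> \<le> L * (h * B) + L * h"
    using XZ h \<open>0 \<le> L\<close> by (intro add_mono mult_left_mono) auto
  finally have KE: "frob_norm (F X a - E) \<le> L * (h * B) + L * h" .
  \<comment> \<open>Here \<open>K\<close> is F(X, a) and \<open>T\<close> its truncated SVD, fixed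
    by the projection because the bases also span the columns of \<open>U'\<close> and
    \<open>V'\<close>.\<close>
  have "frob_norm ((X + h \<cdot>\<^sub>m F X a) - Z) \<le> 2 * h * \<epsilon>1 + h * (L * (h * B) + L * h)"
    unfolding Z_eq
    by (rule galerkin_euler_error[OF W1(1,2) W2(1,2) X(1) pX _
          two_sided_proj_fixes[OF W1(1) W2(1) T(1) diag T(2) W1(4) W2(4)] car[OF X(1)] T(3) E KE])
      (use T(1,2) h in auto)
  also have "\<dots> = L * (B + 1) * h\<^sup>2 + 2 * h * \<epsilon>1"
    by (simp add: algebra_simps power2_eq_square)
  finally have euler: "frob_norm ((X + h \<cdot>\<^sub>m F X a) - Z) \<le> L * (B + 1) * h\<^sup>2 + 2 * h * \<epsilon>1" .
  define T2 where "T2 = P * diag_of \<rho> * Q\<^sup>T"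
  have T2: "T2 \<in> carrier_mat r s"
    using S'(1,2) by (intro carrier_matI) (auto simp: T2_def r_def s_def)
  show Yc: "Y \<in> carrier_mat m n"
    using W1c W2c by (intro carrier_matI) (auto simp: Y)
  \<comment> \<open>The truncation acts on the coefficients \<open>S\<close>; the orthonormal bases
    carry its error over to the full matrices without changing the norm.\<close>
  have "Z - Y = W1 * (S - T2) * W2\<^sup>T"
    unfolding Z_def Y T2_def[symmetric] using W1c W2c T2 S[folded r_def s_def]
    by (simp add: mult_minus_distrib_mat[of W1 m r _ s] minus_mult_distrib_mat[of _ m s])
  then have "frob_norm (Z - Y) = frob_norm (S - T2)"
    using W1(2) W2(2) W1c W2c T2 by (simp add: frob_norm_two_sided[of W1 m r W2 n s] minus_carrier_mat)
  then have trunc: "frob_norm (Z - Y) \<le> \<epsilon>2"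
    using S'(3) by (simp add: T2_def)
  show "frob_norm ((X + h \<cdot>\<^sub>m F X a) - Y) \<le> L * (B + 1) * h\<^sup>2 + 2 * h * \<epsilon>1 + \<epsilon>2"
    using X(1) car[OF X(1)] by (intro frob_norm_diff_triangle_le[OF _ Z Yc euler trunc]) auto
qed

section \<open>One-step error bound with an explicit constant\<close>

theorem lemma3p3:
  fixes L B :: real
  shows "\<exists>C \<delta>. \<delta> > 0 \<and>
    (\<forall>(m1::nat) (m2::nat) (k::nat) (Aj :: nat \<Rightarrow> real mat) (Bj :: nat \<Rightarrow> real mat)
        (G :: real \<Rightarrow> real mat) (F :: real mat \<Rightarrow> real \<Rightarrow> real mat)
        (tn::real) (dt::real) (\<epsilon>1::real) (\<epsilon>2::real)
        (Xn :: real mat) (U :: real mat) (\<sigma> :: real list) (V :: real mat)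
        (X :: real \<Rightarrow> real mat) (Y :: real mat).
      (\<forall>j<k. Aj j \<in> carrier_mat m1 m1 \<and> Bj j \<in> carrier_mat m2 m2) \<longrightarrow>
      (\<forall>t. G t \<in> carrier_mat m1 m2) \<longrightarrow>
      F = affine_rhs m1 m2 k Aj Bj G \<longrightarrow>
      (\<forall>M\<in>carrier_mat m1 m2. \<forall>Z\<in>carrier_mat m1 m2. \<forall>s t.
         frob_norm (F M s - F Z t) \<le> L * frob_norm (M - Z) + L * \<bar>s - t\<bar>) \<longrightarrow>
      (\<forall>M\<in>carrier_mat m1 m2. \<forall>t. frob_norm (F M t) \<le> B) \<longrightarrow>
      0 \<le> \<epsilon>1 \<longrightarrow> 0 \<le> \<epsilon>2 \<longrightarrow>
      Xn \<in> carrier_mat m1 m2 \<longrightarrow> is_svd Xn U \<sigma> V \<longrightarrow>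
      0 < dt \<longrightarrow> dt < \<delta> \<longrightarrow>
      ode_solution m1 m2 F tn (tn + dt) X \<longrightarrow> X tn = Xn \<longrightarrow>
      cheap_prediction_step m1 m2 F \<epsilon>1 \<epsilon>2 tn dt U V Xn Y \<longrightarrow>
      frob_norm (X (tn + dt) - Y) \<le> C * dt\<^sup>2 + 2 * dt * \<epsilon>1 + \<epsilon>2)"
\<comment> \<open>Each of the two comparisons with the Euler step contributes
  \<open>L * (B + 1)\<close> to \<open>C\<close>; the value 1 for \<open>\<delta>\<close> is an
  arbitrary positive choice.\<close>
proof (rule exI[of _ "2 * L * (B + 1)"], rule exI[of _ 1], intro conjI allI impI, goal_cases)
  case 1
  show ?case by simp
next
  case (2 m1 m2 k Aj Bj G F tn dt \<epsilon>1 \<epsilon>2 Xn U \<sigma> V X Y)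
  have car: "F M t \<in> carrier_mat m1 m2" for M t
    using 2(2,3) by (simp add: affine_rhs_carrier)
  have lip: "frob_norm (F M s - F Z t) \<le> L * frob_norm (M - Z) + L * \<bar>s - t\<bar>"
    if "M \<in> carrier_mat m1 m2" "Z \<in> carrier_mat m1 m2" for M Z s t
    using 2(4) that by blast
  have bnd: "frob_norm (F M t) \<le> B" if "M \<in> carrier_mat m1 m2" for M t
    using 2(5) that by blast
  have "Xn - Xn = 0\<^sub>m m1 m2"
    using 2(8) by (intro eq_matI) auto
  \<comment> \<open>The Lipschitz bound at equal matrices and times 1 and 0 has right-hand side
    \<open>L\<close>, which therefore bounds a norm.\<close>
  then have L: "0 \<le> L"
    using order_trans[OF frob_norm_nonneg lip[OF 2(8,8), of 1 0]] by simp
  have B: "0 \<le> B"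
    using order_trans[OF frob_norm_nonneg bnd[OF 2(8)]] .
  have X1: "X (tn + dt) \<in> carrier_mat m1 m2"
    using 2(10,12) by (auto simp: ode_solution_def)
  have exact: "frob_norm (X (tn + dt) - (Xn + dt \<cdot>\<^sub>m F Xn tn)) \<le> L * (B + 1) * dt\<^sup>2"
    using exact_euler_error[OF 2(12,10) car lip bnd L B] 2(13) by simp
  note scheme = cheap_prediction_step_error[OF 2(14,8,9,10) car lip bnd L 2(6,7)]
  have "frob_norm (X (tn + dt) - Y)
      \<le> L * (B + 1) * dt\<^sup>2 + (L * (B + 1) * dt\<^sup>2 + 2 * dt * \<epsilon>1 + \<epsilon>2)"
    by (rule frob_norm_diff_triangle_le[OF X1 _ scheme(1) exact scheme(2)])
      (use 2(8) car in auto)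
  then show ?case
    by (simp add: algebra_simps)
qed

end
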